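(* Let $X$ and $Y$ be nonempty finite sets, let $G \subseteq \mathrm{Aut}(X)$ and $K \subseteq \mathrm{Aut}(Y)$ be subgroups, and let $T \colon G \to K$ be a group homomorphism. Suppose that $T(G)$ acts transitively on $Y$, and let $F$ be a map from $\mathbb{R}^X$ to $\mathbb{R}^Y$. Then $(F,T)$ is a linear GEO from $(\mathbb{R}^X,G)$ to $(\mathbb{R}^Y,K)$ if and only if there exists a generalized $T$-permutant measure $\mu$ such that $F(\varphi)=\sum_{h\in X^Y}\mu(h)\,(\varphi\circ h)$ for every $\varphi\in\mathbb{R}^X$.
   Context: For a finite set $Z$, $\mathbb{R}^Z$ is the space of all functions $Z\to\mathbb{R}$ and $\mathrm{Aut}(Z)$ is the group of all bijections $Z\to Z$ under composition, acting on $\mathbb{R}^Z$ by composition on the right. $X^Y$ is the (finite) set of all functions $Y\to X$. Linear GEO: $(F,T)$, with $T\colon G\to K$ a group homomorphism and $F\colon\mathbb{R}^X\to\mathbb{R}^Y$, is a Group Equivariant Operator (GEO) from $(\mathbb{R}^X,G)$ to $(\mathbb{R}^Y,K)$ if $F$ is $T$-equivariant, i.e. $F(\varphi\circ g)=F(\varphi)\circ T(g)$ for all $\varphi\in\mathbb{R}^X$, $g\in G$. It is linear if $F$ is a linear map. Generalized $T$-permutant measure: a finite signed measure $\mu$ on the power set of $X^Y$ that is invariant under the action of $G$ on $X^Y$ given by $(g,h)\mapsto g\circ h\circ T(g^{-1})$; equivalently, writing $\mu(h):=\mu(\{h\})$, $\mu(h)=\mu(g\circ h\circ T(g^{-1}))$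 for all $g\in G$, $h\in X^Y$. *)

theory Defs
  imports "HOL-Analysis.Analysis" "HOL-Algebra.Algebra"
begin

text \<open>
  The finite nonempty sets \<open>X\<close> and \<open>Y\<close> are (arbitrary) types of class \<open>finite\<close>; the function
  space over \<open>X\<close> is \<open>real ^ 'x\<close>, and \<open>X ^ Y\<close> is the finite type \<open>'y \<Rightarrow> 'x\<close>.
\<close>

text \<open>\<open>BijGroup UNIV\<close> is the group of all bijections of the type, with composition as product
  (\<open>extensional UNIV\<close> is no restriction).\<close>

abbreviation Aut :: "('a \<Rightarrow> 'a) monoid" where
  "Aut \<equiv> BijGroup UNIV"

abbreviation subgrp :: "('a \<Rightarrow> 'a) set \<Rightarrow> ('a \<Rightarrow> 'a) monoid" where
  "subgrp H \<equiv> Aut\<lparr>carrier := H\<rparr>"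

definition vcomp :: "real ^ 'x \<Rightarrow> ('y \<Rightarrow> 'x) \<Rightarrow> real ^ 'y"  (infixl "\<circ>\<^sub>v" 75) where
  "\<phi> \<circ>\<^sub>v h = (\<chi> y. \<phi> $ h y)"

definition GEO ::
    "('x \<Rightarrow> 'x) set \<Rightarrow> ('y \<Rightarrow> 'y) set \<Rightarrow> (real ^ 'x \<Rightarrow> real ^ 'y) \<Rightarrow> (('x \<Rightarrow> 'x) \<Rightarrow> ('y \<Rightarrow> 'y)) \<Rightarrow> bool"
  where
  "GEO G K F T \<longleftrightarrow>
     T \<in> hom (subgrp G) (subgrp K) \<and> (\<forall>\<phi>. \<forall>g\<in>G. F (\<phi> \<circ>\<^sub>v g) = F \<phi> \<circ>\<^sub>v T g)"

definition linear_GEO ::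
    "('x::finite \<Rightarrow> 'x) set \<Rightarrow> ('y::finite \<Rightarrow> 'y) set \<Rightarrow>
     (real ^ 'x \<Rightarrow> real ^ 'y) \<Rightarrow> (('x \<Rightarrow> 'x) \<Rightarrow> ('y \<Rightarrow> 'y)) \<Rightarrow> bool"
  where
  "linear_GEO G K F T \<longleftrightarrow> GEO G K F T \<and> linear F"

text \<open>A finite signed measure on the power set: a real-valued countably additive set function.\<close>

definition finite_signed_measure :: "('a set \<Rightarrow> real) \<Rightarrow> bool" where
  "finite_signed_measure \<mu> \<longleftrightarrow>
     \<mu> {} = 0 \<and>
     (\<forall>A :: nat \<Rightarrow> 'a set. disjoint_family A \<longrightarrow> (\<lambda>i. \<mu> (A i)) sums \<mu> (\<Union>i. A i))"

definition perm_act ::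
    "(('x \<Rightarrow> 'x) \<Rightarrow> ('y \<Rightarrow> 'y)) \<Rightarrow> ('x \<Rightarrow> 'x) \<Rightarrow> ('y \<Rightarrow> 'x) \<Rightarrow> ('y \<Rightarrow> 'x)" where
  "perm_act T g h = g \<circ> h \<circ> T (inv\<^bsub>Aut\<^esub> g)"

definition generalized_permutant_measure ::
    "('x \<Rightarrow> 'x) set \<Rightarrow> (('x \<Rightarrow> 'x) \<Rightarrow> ('y \<Rightarrow> 'y)) \<Rightarrow> (('y \<Rightarrow> 'x) set \<Rightarrow> real) \<Rightarrow> bool" where
  "generalized_permutant_measure G T \<mu> \<longleftrightarrow>
     finite_signed_measure \<mu> \<and> (\<forall>g\<in>G. \<forall>A. \<mu> (perm_act T g ` A) = \<mu> A)"

end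

theory Submission
  imports Defs
begin

text \<open>
  Let \<open>b y x\<close> be the matrix of a linear GEO \<open>F\<close>, let \<open>n = |X|\<close> and \<open>N = |Y|\<close>.  Equivariance says
  that \<open>b (T g y) (g x) = b y x\<close>, and since constant functions are fixed by \<open>G\<close> and \<open>T(G)\<close> is
  transitive, all rows of \<open>b\<close> have the same sum \<open>s\<close>.  Then
  \<open>m h = (n * (\<Sum>y. b y (h y)) - (N - 1) * s) / n ^ N\<close> is an invariant weight on the functions
  \<open>h\<close>, and its marginals are the entries of \<open>b\<close>: under the uniform distribution on \<open>X ^ Y\<close> the
  values \<open>h y\<close> are independent and uniform, so the terms \<open>y \<noteq> y0\<close> contribute only multiples of
  \<open>s\<close> to the marginal at \<open>y0\<close>, and these cancel.
\<close>

lemma carrier_Aut: "carrier Aut = {f. bij f}"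
  by (auto simp: BijGroup_def Bij_def)

lemma mult_Aut: "bij f \<Longrightarrow> bij g \<Longrightarrow> f \<otimes>\<^bsub>Aut\<^esub> g = f \<circ> g"
  by (simp add: BijGroup_def Bij_def compose_def comp_def restrict_UNIV)

lemma one_Aut: "\<one>\<^bsub>Aut\<^esub> = id"
  by (auto simp: BijGroup_def restrict_UNIV)

lemma m_inv_Aut: "bij f \<Longrightarrow> inv\<^bsub>Aut\<^esub> f = inv_into UNIV f"
  by (simp add: inv_BijGroup Bij_def restrict_UNIV)

text \<open>Writing \<open>f (h y)\<close> as a product over all coordinates, with factor 1 away
  from \<open>y\<close>, lets the sum over functions factor coordinatewise. The extra factor
  \<open>CARD('x)\<close> on the left keeps the exponent \<open>CARD('y) - 1\<close> out of the
  statement.\<close>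

lemma sum_fun_component:
  fixes f :: "'x::finite \<Rightarrow> real" and y :: "'y::finite"
  shows "real CARD('x) * (\<Sum>h\<in>UNIV. f (h y)) = real CARD('x) ^ CARD('y) * sum f UNIV"
proof -
  have "(\<Sum>h\<in>UNIV. f (h y)) = (\<Sum>h\<in>UNIV. \<Prod>z\<in>UNIV. if z = y then f (h z) else 1)"
    by simp
  also have "\<dots> = (\<Prod>z\<in>UNIV. \<Sum>x\<in>UNIV. if z = y then f x else 1)"
    using prod_sum_PiE[of "UNIV :: 'y set" "\<lambda>_. UNIV :: 'x set" "\<lambda>z x. if z = y then f x else 1"]
    by simp
  also have "\<dots> = (\<Prod>z\<in>UNIV. if z = y then sum f UNIV else real CARD('x))"
    by (rule prod.cong) auto
  also have "\<dots> = sum f UNIV * real CARD('x) ^ (CARD('y) - 1)"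
    by (subst prod.remove[of _ y]) auto
  finally show ?thesis
    by (simp add: power_eq_if)
qed

text \<open>Independence of two distinct coordinates, by the same factorization; the square on the
  left absorbs the two missing factors \<open>CARD('x)\<close>.\<close>

lemma sum_fun_two_components:
  fixes f f' :: "'x::finite \<Rightarrow> real" and y y' :: "'y::finite"
  assumes "y \<noteq> y'"
  shows "real CARD('x) ^ 2 * (\<Sum>h\<in>UNIV. f (h y) * f' (h y'))
       = real CARD('x) ^ CARD('y) * (sum f UNIV * sum f' UNIV)"
proof -
  let ?c = "\<lambda>z x. if z = y then f x else if z = y' then f' x else 1"
  \<comment> \<open>Kept general in \<open>k\<close>: it serves both for the integrand at a fixed
    \<open>h\<close> and for the product of the coordinate sums.\<close>
  have split: "prod k UNIV = k y * (k y' * prod k (UNIV - {y} - {y'}))" for k :: "'y \<Rightarrow> real"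
    using assms by (subst prod.remove[of _ y]; simp; subst prod.remove[of _ y']; simp)
  have "(\<Sum>h\<in>UNIV. f (h y) * f' (h y')) = (\<Sum>h\<in>UNIV. \<Prod>z\<in>UNIV. ?c z (h z))"
    by (rule sum.cong) (use assms in \<open>auto simp: split\<close>)
  also have "\<dots> = (\<Prod>z\<in>UNIV. \<Sum>x\<in>UNIV. ?c z x)"
    using prod_sum_PiE[of "UNIV :: 'y set" "\<lambda>_. UNIV :: 'x set" ?c] by simp
  also have "\<dots> = sum f UNIV * (sum f' UNIV * real CARD('x) ^ (CARD('y) - 2))"
    using assms by (simp add: split card_Diff_singleton_if numeral_2_eq_2)
  finally have eq: "(\<Sum>h\<in>UNIV. f (h y) * f' (h y')) =
      sum f UNIV * (sum f' UNIV * real CARD('x) ^ (CARD('y) - 2))" .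
  \<comment> \<open>Two distinct points make the truncated subtraction \<open>CARD('y) - 2\<close>
    exact.\<close>
  have "card {y, y'} \<le> CARD('y)"
    by (rule card_mono) auto
  then have "2 \<le> CARD('y)"
    using assms by simp
  then have "real CARD('x) ^ CARD('y) = real CARD('x) ^ 2 * real CARD('x) ^ (CARD('y) - 2)"
    by (metis le_add_diff_inverse power_add)
  then show ?thesis
    by (simp add: eq)
qed

text \<open>Over a finite type such a set function is a finite linear combination of indicators,
  each of which is countably additive. This turns point weights into a measure.\<close>

lemma finite_signed_measure_sum:
  fixes m :: "'a::finite \<Rightarrow> real"
  shows "finite_signed_measure (\<lambda>A. sum m A)"
proof -
  have "(\<lambda>i. sum m (A i)) sums sum m (\<Union>i. A i)"
    if "disjoint_family A" for A :: "nat \<Rightarrow> 'a set"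
  proof -
    have sum_eq: "sum m B = (\<Sum>a\<in>UNIV. m a * indicator B a)" for B
      by (simp add: indicator_def sum.If_cases)
    have "(\<lambda>i. indicator (A i) a :: real) sums indicator (\<Union>i. A i) a" for a
      by (rule indicator_sums) (use that in \<open>auto simp: disjoint_family_on_def\<close>)
    then show ?thesis
      unfolding sum_eq by (intro sums_sum sums_mult)
  qed
  then show ?thesis
    by (simp add: finite_signed_measure_def)
qed

lemma vcomp_nth [simp]: "(\<phi> \<circ>\<^sub>v h) $ y = \<phi> $ h y"
  by (simp add: vcomp_def)

text \<open>Used to read equivariance on basis vectors as an invariance of matrix entries.\<close>

lemma axis_vcomp:
  fixes g :: "'x::finite \<Rightarrow> 'x"
  assumes "inj g"
  shows "axis (g x) 1 \<circ>\<^sub>v g = axis x 1"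
  using assms by (auto simp: vec_eq_iff axis_def inj_eq)

lemma linear_nth_eq_sum:
  fixes F :: "real ^ 'x::finite \<Rightarrow> real ^ 'y::finite"
  assumes "linear F"
  shows "F \<phi> $ y = (\<Sum>x\<in>UNIV. F (axis x 1) $ y * \<phi> $ x)"
  using Cartesian_Space.linear_componentwise[of F \<phi> y] assms
  by (simp add: linear_matrix_vector_mul_eq mult.commute)

theorem theorem4p1:
  fixes G :: "('x::finite \<Rightarrow> 'x) set"
    and K :: "('y::finite \<Rightarrow> 'y) set"
    and T :: "('x \<Rightarrow> 'x) \<Rightarrow> ('y \<Rightarrow> 'y)"
    and F :: "real ^ 'x \<Rightarrow> real ^ 'y"
  assumes "subgroup G Aut"
    and "subgroup K Aut"
    and "T \<in> hom (subgrp G) (subgrp K)"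
    and "transitive_action (subgrp (T ` G)) UNIV (\<lambda>k. k)"
  shows "linear_GEO G K F T \<longleftrightarrow>
    (\<exists>\<mu>. generalized_permutant_measure G T \<mu> \<and>
         (\<forall>\<phi>. F \<phi> = (\<Sum>h\<in>UNIV. \<mu> {h} *\<^sub>R (\<phi> \<circ>\<^sub>v h))))"
proof -
  have bij: "bij g" if "g \<in> G" for g
    using subgroup.subset[OF assms(1)] that by (auto simp: carrier_Aut)
  have bijK: "bij k" if "k \<in> K" for k
    using subgroup.subset[OF assms(2)] that by (auto simp: carrier_Aut)
  have TK: "T g \<in> K" if "g \<in> G" for g
    using assms(3) that by (auto simp: hom_def)
  have bijT: "bij (T g)" if "g \<in> G" for g
    using that by (intro bijK TK)
  have T_comp: "T (g \<circ> g') = T g \<circ> T g'" if "g \<in> G" "g' \<in> G" for g g'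
    using assms(3) that by (auto simp: hom_def mult_Aut bij bijT)
  have invG: "inv\<^bsub>Aut\<^esub> g \<in> G" if "g \<in> G" for g
    using subgroup.m_inv_closed[OF assms(1) that] .
  have idG: "id \<in> G"
    using subgroup.one_closed[OF assms(1)] by (simp add: one_Aut)
  have T_id: "T id = id"
  proof -
    \<comment> \<open>\<open>T id\<close> is idempotent, and an injective idempotent map is the
      identity.\<close>
    have "T id (T id y) = T id y" for y
      using T_comp[OF idG idG] by (metis comp_id comp_apply)
    then show ?thesis
      using bij_is_inj[OF bijT[OF idG]] by (auto simp: inj_eq)
  qed
  have inv_eq: "(inv\<^bsub>Aut\<^esub> g) (g x) = x" "g ((inv\<^bsub>Aut\<^esub> g) x) = x" if "g \<in> G" for g x
    using bij[OF that]
    by (simp_all add: m_inv_Aut bij_is_inj bij_is_surj surj_f_inv_f)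
  have T_inv_eq: "T (inv\<^bsub>Aut\<^esub> g) (T g y) = y" "T g (T (inv\<^bsub>Aut\<^esub> g) y) = y" if "g \<in> G" for g y
  proof -
    have "(inv\<^bsub>Aut\<^esub> g) \<circ> g = id" "g \<circ> (inv\<^bsub>Aut\<^esub> g) = id"
      using inv_eq[OF that] by auto
    then have "T (inv\<^bsub>Aut\<^esub> g) \<circ> T g = id" "T g \<circ> T (inv\<^bsub>Aut\<^esub> g) = id"
      using T_comp[OF that invG[OF that]] T_comp[OF invG[OF that] that] by (simp_all add: T_id)
    then show "T (inv\<^bsub>Aut\<^esub> g) (T g y) = y" "T g (T (inv\<^bsub>Aut\<^esub> g) y) = y"
      by (metis comp_apply id_apply)+
  qed
  \<comment> \<open>The inverse is the action of the inverse of \<open>g\<close>, written with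
    \<open>T g\<close> itself.\<close>
  have bij_act: "bij (perm_act T g)" if g: "g \<in> G" for g
  proof (rule bij_betw_byWitness[where f' = "\<lambda>h. (inv\<^bsub>Aut\<^esub> g) \<circ> h \<circ> T g"])
  qed (auto simp: perm_act_def fun_eq_iff inv_eq[OF g] T_inv_eq[OF g])
  have trans: "\<exists>g\<in>G. T g y = y'" for y y'
  proof -
    have "\<exists>k\<in>carrier (subgrp (T ` G)). k y = y'"
      using transitive_action.unique_orbit[OF assms(4)] by auto
    then show ?thesis by auto
  qed
  show ?thesis
  proof
    assume "linear_GEO G K F T"
    then have lin: "linear F" and equiv: "\<And>\<phi> g. g \<in> G \<Longrightarrow> F (\<phi> \<circ>\<^sub>v g) = F \<phi> \<circ>\<^sub>v T g"
      by (auto simp: linear_GEO_def GEO_def)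
    define b where "b y x = F (axis x 1) $ y" for y x
    \<comment> \<open>\<open>undefined\<close> is just some point of Y; \<open>row\<close> shows
      that every other row has the same sum.\<close>
    define s where "s = (\<Sum>x\<in>UNIV. b undefined x)"
    define n where "n = real CARD('x)"
    define N where "N = CARD('y)"
    define m where "m h = (n * (\<Sum>y\<in>UNIV. b y (h y)) - (real N - 1) * s) / n ^ N"
      for h :: "'y \<Rightarrow> 'x"
    have n: "n > 0"
      by (simp add: n_def)
    have F_eq: "F \<phi> $ y = (\<Sum>x\<in>UNIV. b y x * \<phi> $ x)" for \<phi> y
      unfolding b_def by (rule linear_nth_eq_sum[OF lin])
    have b_inv: "b (T g y) (g x) = b y x" if g: "g \<in> G" for g x y
    proof -
      have "F (axis x 1) $ y = F (axis (g x) 1 \<circ>\<^sub>v g) $ y"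
        using bij_is_inj[OF bij[OF g]] by (simp add: axis_vcomp)
      also have "\<dots> = F (axis (g x) 1) $ T g y"
        by (simp add: equiv[OF g])
      finally show ?thesis
        by (simp add: b_def)
    qed
    have row: "(\<Sum>x\<in>UNIV. b y x) = s" for y
    proof -
      obtain g where g: "g \<in> G" "T g undefined = y"
        using trans by blast
      \<comment> \<open>Reindexing by \<open>g\<close> makes the row of \<open>y\<close> a
        permutation of the row of \<open>undefined\<close>.\<close>
      have "(\<Sum>x\<in>UNIV. b y x) = (\<Sum>x\<in>UNIV. b (T g undefined) (g x))"
        unfolding g(2) by (rule sum.reindex_bij_betw[OF bij[OF g(1)], symmetric])
      then show ?thesis
        by (simp add: b_inv[OF g(1)] s_def)
    qed
    have m_inv: "m (perm_act T g h) = m h" if g: "g \<in> G" for g h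
    proof -
      \<comment> \<open>Evaluating at \<open>T g y\<close> cancels the inner T of the inverse and
        leaves \<open>b (T g y) (g (h y))\<close>.\<close>
      have "(\<Sum>y\<in>UNIV. b y (perm_act T g h y)) = (\<Sum>y\<in>UNIV. b (T g y) (perm_act T g h (T g y)))"
        by (rule sum.reindex_bij_betw[OF bijT[OF g], symmetric])
      also have "\<dots> = (\<Sum>y\<in>UNIV. b y (h y))"
        by (simp add: perm_act_def T_inv_eq[OF g] b_inv[OF g])
      finally show ?thesis
        by (simp add: m_def)
    qed
    have "generalized_permutant_measure G T (\<lambda>A. sum m A)"
      unfolding generalized_permutant_measure_def
    proof (intro conjI finite_signed_measure_sum ballI allI)
      fix g A assume g: "g \<in> G"
      show "sum m (perm_act T g ` A) = sum m A"
        using inj_on_subset[OF bij_is_inj[OF bij_act[OF g]]] by (simp add: sum.reindex m_inv[OF g])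
    qed
    moreover have "F \<phi> = (\<Sum>h\<in>UNIV. sum m {h} *\<^sub>R (\<phi> \<circ>\<^sub>v h))" for \<phi>
    proof (subst vec_eq_iff, rule allI)
      fix y0
      let ?S = "\<Sum>x\<in>UNIV. \<phi> $ x"
      let ?E = "\<lambda>y. \<Sum>h\<in>UNIV. b y (h y) * \<phi> $ h y0"
      have diag: "n * ?E y0 = n ^ N * F \<phi> $ y0"
        unfolding n_def N_def F_eq by (rule sum_fun_component)
      have mass: "n * (\<Sum>h\<in>(UNIV :: ('y \<Rightarrow> 'x) set). \<phi> $ h y0) = n ^ N * ?S"
        unfolding n_def N_def by (rule sum_fun_component)
      \<comment> \<open>By independence the off-diagonal term is a row sum times \<open>?S\<close>,
        hence the same for all \<open>y \<noteq> y0\<close>.\<close>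
      have off: "n * (n * ?E y) = n ^ N * (s * ?S)" if "y \<noteq> y0" for y
        using sum_fun_two_components[OF that, of "b y" "\<lambda>x. \<phi> $ x"]
        by (simp add: row n_def N_def power2_eq_square mult.assoc)
      \<comment> \<open>The factor \<open>n ^ N\<close> clears the denominator of \<open>m\<close>;
        the further \<open>n\<close> is needed because \<open>off\<close> uses two factors
        \<open>n\<close>.\<close>
      have "n * (n ^ N * (\<Sum>h\<in>UNIV. m h * \<phi> $ h y0))
          = n * (\<Sum>h\<in>UNIV. (n * (\<Sum>y\<in>UNIV. b y (h y)) - (real N - 1) * s) * \<phi> $ h y0)"
        using n by (simp add: m_def sum_distrib_left)
      also have "\<dots> = n * (n * (\<Sum>h\<in>UNIV. \<Sum>y\<in>UNIV. b y (h y) * \<phi> $ h y0)) -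
          (real N - 1) * s * (n * (\<Sum>h\<in>(UNIV :: ('y \<Rightarrow> 'x) set). \<phi> $ h y0))"
        by (simp add: algebra_simps sum_subtractf sum.distrib sum_distrib_left sum_distrib_right)
      also have "(\<Sum>h\<in>UNIV. \<Sum>y\<in>UNIV. b y (h y) * \<phi> $ h y0) = (\<Sum>y\<in>UNIV. ?E y)"
        by (rule sum.swap)
      also have "n * (n * (\<Sum>y\<in>UNIV. ?E y)) = (\<Sum>y\<in>UNIV. n * (n * ?E y))"
        by (simp only: sum_distrib_left)
      also have "\<dots> = n * (n * ?E y0) + (\<Sum>y\<in>UNIV - {y0}. n * (n * ?E y))"
        by (rule sum.remove) auto
      also have "(\<Sum>y\<in>UNIV - {y0}. n * (n * ?E y)) = (\<Sum>y\<in>UNIV - {y0}. n ^ N * (s * ?S))"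
        by (rule sum.cong) (auto simp: off)
      also have "\<dots> = (real N - 1) * (n ^ N * (s * ?S))"
        by (simp add: N_def card_Diff_singleton_if of_nat_diff)
      \<comment> \<open>The \<open>N - 1\<close> equal off-diagonal terms cancel against the
        correction \<open>(real N - 1) * s\<close> in \<open>m\<close>, leaving the diagonal
        term.\<close>
      finally have "n * (n ^ N * (\<Sum>h\<in>UNIV. m h * \<phi> $ h y0)) = n * (n ^ N * F \<phi> $ y0)"
        unfolding diag mass by (simp add: algebra_simps)
      then show "F \<phi> $ y0 = (\<Sum>h\<in>UNIV. sum m {h} *\<^sub>R (\<phi> \<circ>\<^sub>v h)) $ y0"
        using n by simp
    qed
    ultimately show "\<exists>\<mu>. generalized_permutant_measure G T \<mu> \<and>
         (\<forall>\<phi>. F \<phi> = (\<Sum>h\<in>UNIV. \<mu> {h} *\<^sub>R (\<phi> \<circ>\<^sub>v h)))"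
      by (intro exI[of _ "\<lambda>A. sum m A"]) blast
  next
    assume "\<exists>\<mu>. generalized_permutant_measure G T \<mu> \<and>
         (\<forall>\<phi>. F \<phi> = (\<Sum>h\<in>UNIV. \<mu> {h} *\<^sub>R (\<phi> \<circ>\<^sub>v h)))"
    then obtain \<mu> where inv: "\<And>g A. g \<in> G \<Longrightarrow> \<mu> (perm_act T g ` A) = \<mu> A"
      and F: "\<And>\<phi>. F \<phi> = (\<Sum>h\<in>UNIV. \<mu> {h} *\<^sub>R (\<phi> \<circ>\<^sub>v h))"
      by (auto simp: generalized_permutant_measure_def)
    have "linear F"
      by (rule linearI)
        (simp_all add: F vec_eq_iff sum.distrib sum_distrib_left algebra_simps)
    moreover have "F (\<phi> \<circ>\<^sub>v g) = F \<phi> \<circ>\<^sub>v T g" if g: "g \<in> G" for \<phi> g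
    proof (subst vec_eq_iff, rule allI)
      fix y
      have "(F \<phi> \<circ>\<^sub>v T g) $ y = (\<Sum>h\<in>UNIV. \<mu> {h} * \<phi> $ h (T g y))"
        by (simp add: F)
      \<comment> \<open>After this reindexing, invariance on singletons removes the action from the
        weight, and the value at \<open>T g y\<close> becomes \<open>g (h y)\<close>.\<close>
      also have "\<dots> = (\<Sum>h\<in>UNIV. \<mu> {perm_act T g h} * \<phi> $ perm_act T g h (T g y))"
        by (rule sum.reindex_bij_betw[OF bij_act[OF g], symmetric])
      also have "\<dots> = F (\<phi> \<circ>\<^sub>v g) $ y"
        using inv[OF g, of "{_}"] by (simp add: F perm_act_def T_inv_eq[OF g])
      finally show "F (\<phi> \<circ>\<^sub>v g) $ y = (F \<phi> \<circ>\<^sub>v T g) $ y" ..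
    qed
    ultimately show "linear_GEO G K F T"
      using assms(3) by (simp add: linear_GEO_def GEO_def)
  qed
qed

end
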